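(* Let $P(x_0,x_1,\ldots,x_n)\in\mathbb{C}[x_0,x_1,\ldots,x_n]$ be a polynomial. (i) If $\mathcal{D}_{\mathcal{F}}(P(x_0,x_1,\ldots,x_n))=0$, then $P(F_0(x),F_1(x),\ldots,F_n(x))$ is a constant (i.e. a polynomial in $x$ lying in $\mathbb{C}$). (ii) If $\mathcal{D}_{\mathcal{L}}(P(x_0,x_1,\ldots,x_n))=0$, then $P(L_0(x),L_1(x),\ldots,L_n(x))$ is a constant.
   Context: The Fibonacci polynomials $F_n(x)$ and Lucas polynomials $L_n(x)$ are defined by the generating functions $\sum_{n\ge 0}F_n(x)t^n=\frac{t}{1-xt-t^2}$ and $\sum_{n\ge 0}L_n(x)t^n=\frac{1+t^2}{1-xt-t^2}$ (so $L_0(x)=1$). The Fibonacci derivation $\mathcal{D}_{\mathcal{F}}$ and the Lucas derivation $\mathcal{D}_{\mathcal{L}}$ are the $\mathbb{C}$-linear derivations of $\mathbb{C}[x_0,\ldots,x_n]$ determined by $\mathcal{D}_{\mathcal{F}}(x_0)=0$, $\mathcal{D}_{\mathcal{L}}(x_0)=0$ and, for $1\le m\le n$, $$\mathcal{D}_{\mathcal{F}}(x_m)=\sum_{k=0}^{\lfloor (m-1)/2\rfloor}(-1)^k(m-1-2k)\,x_{m-1-2k},\qquad \mathcal{D}_{\mathcal{L}}(x_m)=m\sum_{k=0}^{\lfloor (m-1)/2\rfloor}(-1)^k x_{m-1-2k}.$$ In particular $\mathcal{D}_{\mathcal{F}}(x_1)=0$, $\mathcal{D}_{\mathcal{L}}(x_1)=x_0$.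 *)

theory Defs
  imports Complex_Main "HOL-Library.Poly_Mapping"
    "HOL-Computational_Algebra.Polynomial"
    "HOL-Computational_Algebra.Formal_Power_Series"
begin

section \<open>Multivariate polynomials\<close>

text \<open>
  A polynomial in the variables \<open>x\<^sub>0, x\<^sub>1, \<dots>\<close> is a finitely supported map from exponent vectors
  to coefficients. The ring structure is the convolution product provided by
  \<^theory>\<open>HOL-Library.Poly_Mapping\<close>.
\<close>

type_synonym 'a mpoly = "(nat \<Rightarrow>\<^sub>0 nat) \<Rightarrow>\<^sub>0 'a"

definition Const :: "'a::zero \<Rightarrow> 'a mpoly"
  where "Const c = Poly_Mapping.single 0 c"

definition Var :: "nat \<Rightarrow> 'a::zero_neq_one mpoly"
  where "Var i = Poly_Mapping.single (Poly_Mapping.single i 1) 1"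

text \<open>The ring of polynomials in the variables \<open>x\<^sub>0, \<dots>, x\<^sub>n\<close>.\<close>

definition mpoly_ring :: "nat \<Rightarrow> 'a::zero mpoly set"
  where "mpoly_ring n = {p. \<forall>m\<in>Poly_Mapping.keys p. Poly_Mapping.keys m \<subseteq> {0..n}}"

text \<open>
  Substitution of \<open>f i\<close> for \<open>x\<^sub>i\<close>, where the coefficients are carried into the target ring by \<open>c\<close>.
\<close>

definition mpoly_eval :: "('a::zero \<Rightarrow> 'b::comm_semiring_1) \<Rightarrow> (nat \<Rightarrow> 'b) \<Rightarrow> 'a mpoly \<Rightarrow> 'b"
  where "mpoly_eval c f p = (\<Sum>m\<in>Poly_Mapping.keys p.
    c (Poly_Mapping.lookup p m) *
    (\<Prod>i\<in>Poly_Mapping.keys m. f i ^ Poly_Mapping.lookup m i))"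

section \<open>Derivations\<close>

definition derivation :: "nat \<Rightarrow> (complex mpoly \<Rightarrow> complex mpoly) \<Rightarrow> bool" where
  "derivation n D \<longleftrightarrow>
     (\<forall>p\<in>mpoly_ring n. D p \<in> mpoly_ring n) \<and>
     (\<forall>p\<in>mpoly_ring n. \<forall>q\<in>mpoly_ring n. D (p + q) = D p + D q) \<and>
     (\<forall>c. \<forall>p\<in>mpoly_ring n. D (Const c * p) = Const c * D p) \<and>
     (\<forall>p\<in>mpoly_ring n. \<forall>q\<in>mpoly_ring n. D (p * q) = D p * q + p * D q)"

text \<open>
  In the two definitions below \<open>2 * k \<le> m - 1\<close> and \<open>m \<ge> 1\<close>, so no subtraction of natural numbers
  is truncated.
\<close>

definition fibonacci_derivation :: "nat \<Rightarrow> (complex mpoly \<Rightarrow> complex mpoly) \<Rightarrow> bool" where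
  "fibonacci_derivation n D \<longleftrightarrow> derivation n D \<and> D (Var 0) = 0 \<and>
     (\<forall>m\<in>{1..n}. D (Var m) =
        (\<Sum>k=0..(m - 1) div 2. (-1) ^ k * of_nat (m - 1 - 2 * k) * Var (m - 1 - 2 * k)))"

definition lucas_derivation :: "nat \<Rightarrow> (complex mpoly \<Rightarrow> complex mpoly) \<Rightarrow> bool" where
  "lucas_derivation n D \<longleftrightarrow> derivation n D \<and> D (Var 0) = 0 \<and>
     (\<forall>m\<in>{1..n}. D (Var m) =
        of_nat m * (\<Sum>k=0..(m - 1) div 2. (-1) ^ k * Var (m - 1 - 2 * k)))"

section \<open>Fibonacci and Lucas polynomials\<close>

text \<open>
  Power series in \<open>t\<close> over the polynomials in \<open>x\<close>; here \<open>x\<close> is \<open>[:0, 1:]\<close> and \<open>t\<close> is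
  \<^const>\<open>fps_X\<close>. The denominator has constant coefficient 1, which is the inverse of itself, as
  required by the second argument of \<^const>\<open>fps_right_inverse\<close>. (The division of power series
  cannot be used, since the coefficient ring is not a field.)
\<close>

definition gf_denom :: "complex poly fps"
  where "gf_denom = 1 - fps_const [:0, 1:] * fps_X - fps_X ^ 2"

definition fibonacci_gf :: "complex poly fps"
  where "fibonacci_gf = fps_X * fps_right_inverse gf_denom 1"

definition lucas_gf :: "complex poly fps"
  where "lucas_gf = (1 + fps_X ^ 2) * fps_right_inverse gf_denom 1"

definition fibonacci_poly :: "nat \<Rightarrow> complex poly"
  where "fibonacci_poly m = fps_nth fibonacci_gf m"

definition lucas_poly :: "nat \<Rightarrow> complex poly"
  where "lucas_poly m = fps_nth lucas_gf m"

lemma gf_denom_inverse: "gf_denom * fps_right_inverse gf_denom 1 = 1"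
  by (rule fps_right_inverse) (simp add: gf_denom_def)

lemma fibonacci_gf: "fibonacci_gf * gf_denom = fps_X"
  by (simp add: fibonacci_gf_def mult.assoc mult.commute[of _ gf_denom] gf_denom_inverse)

lemma lucas_gf: "lucas_gf * gf_denom = 1 + fps_X ^ 2"
  by (simp add: lucas_gf_def mult.assoc mult.commute[of _ gf_denom] gf_denom_inverse)

section \<open>Existence of the two derivations\<close>

text \<open>
  Substitution is a ring homomorphism, and the derivation with prescribed values \<open>g i\<close> on the
  variables is the coefficient of \<open>\<epsilon>\<close> in the result of substituting \<open>x\<^sub>i + \<epsilon> g i\<close> for \<open>x\<^sub>i\<close>.
\<close>

lemma mpoly_sum_single:
  "p = (\<Sum>m\<in>Poly_Mapping.keys p. Poly_Mapping.single m (Poly_Mapping.lookup p m))"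
  by (rule poly_mapping_eqI)
    (auto simp: lookup_sum lookup_single when_def sum.delta in_keys_iff)

lemma mpoly_eval_superset:
  assumes "finite S" "Poly_Mapping.keys p \<subseteq> S" "c 0 = 0"
  shows "mpoly_eval c f p = (\<Sum>m\<in>S. c (Poly_Mapping.lookup p m) *
    (\<Prod>i\<in>Poly_Mapping.keys m. f i ^ Poly_Mapping.lookup m i))"
  unfolding mpoly_eval_def
  by (rule sum.mono_neutral_left) (use assms in \<open>auto simp: in_keys_iff\<close>)

lemma mpoly_eval_add:
  assumes "c 0 = 0" "\<And>x y. c (x + y) = c x + c y"
  shows "mpoly_eval c f (p + q) = mpoly_eval c f p + mpoly_eval c f q"
proof -
  let ?S = "Poly_Mapping.keys p \<union> Poly_Mapping.keys q"
  have "mpoly_eval c f r = (\<Sum>m\<in>?S. c (Poly_Mapping.lookup r m) *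
      (\<Prod>i\<in>Poly_Mapping.keys m. f i ^ Poly_Mapping.lookup m i))"
    if "Poly_Mapping.keys r \<subseteq> ?S" for r
    using that assms(1) by (intro mpoly_eval_superset) auto
  from this[of p] this[of q] this[of "p + q"] show ?thesis
    using keys_add[of p q] by (simp add: assms(2) lookup_add distrib_right sum.distrib)
qed

lemma mpoly_eval_sum:
  assumes "c 0 = 0" "\<And>x y. c (x + y) = c x + c y"
  shows "mpoly_eval c f (\<Sum>i\<in>A. p i) = (\<Sum>i\<in>A. mpoly_eval c f (p i))"
proof (induction A rule: infinite_finite_induct)
  case (insert a A)
  then show ?case using assms by (simp add: mpoly_eval_add)
qed (simp_all add: mpoly_eval_def)

lemma monom_eval_add:
  fixes f :: "nat \<Rightarrow> 'b::comm_semiring_1"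
  shows "(\<Prod>i\<in>Poly_Mapping.keys (a + b). f i ^ Poly_Mapping.lookup (a + b) i) =
    (\<Prod>i\<in>Poly_Mapping.keys a. f i ^ Poly_Mapping.lookup a i) *
    (\<Prod>i\<in>Poly_Mapping.keys b. f i ^ Poly_Mapping.lookup b i)"
proof -
  let ?S = "Poly_Mapping.keys a \<union> Poly_Mapping.keys b"
  have "(\<Prod>i\<in>Poly_Mapping.keys r. f i ^ Poly_Mapping.lookup r i) =
      (\<Prod>i\<in>?S. f i ^ Poly_Mapping.lookup r i)" if "Poly_Mapping.keys r \<subseteq> ?S" for r
    by (rule prod.mono_neutral_left) (use that in \<open>auto simp: in_keys_iff\<close>)
  from this[of a] this[of b] this[of "a + b"] show ?thesis
    using keys_add[of a b] by (simp add: lookup_add power_add prod.distrib)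
qed

lemma mpoly_eval_single:
  assumes "c 0 = 0"
  shows "mpoly_eval c f (Poly_Mapping.single m x) =
    c x * (\<Prod>i\<in>Poly_Mapping.keys m. f i ^ Poly_Mapping.lookup m i)"
  using assms by (subst mpoly_eval_superset[where S = "{m}"]) auto

lemma mpoly_eval_Const: "c 0 = 0 \<Longrightarrow> mpoly_eval c f (Const x) = c x"
  by (simp add: Const_def mpoly_eval_single)

lemma mpoly_eval_Var: "c 0 = 0 \<Longrightarrow> c 1 = 1 \<Longrightarrow> mpoly_eval c f (Var i) = f i"
  by (simp add: Var_def mpoly_eval_single)

lemma mpoly_eval_mult:
  fixes p q :: "'a::comm_semiring_1 mpoly"
  assumes c: "c 0 = 0" "\<And>x y. c (x + y) = c x + c y" "\<And>x y. c (x * y) = c x * c y"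
  shows "mpoly_eval c f (p * q) = mpoly_eval c f p * mpoly_eval c f q"
proof -
  let ?s = "\<lambda>p m. Poly_Mapping.single m (Poly_Mapping.lookup p m)"
  have pq: "p * q = (\<Sum>a\<in>Poly_Mapping.keys p. \<Sum>b\<in>Poly_Mapping.keys q. ?s p a * ?s q b)"
    by (subst mpoly_sum_single[of p], subst mpoly_sum_single[of q]) (simp add: sum_product)
  have s: "mpoly_eval c f (?s p a * ?s q b) =
      (c (Poly_Mapping.lookup p a) * (\<Prod>i\<in>Poly_Mapping.keys a. f i ^ Poly_Mapping.lookup a i)) *
      (c (Poly_Mapping.lookup q b) * (\<Prod>i\<in>Poly_Mapping.keys b. f i ^ Poly_Mapping.lookup b i))"
    for a b
    by (simp only: mult_single mpoly_eval_single[where c = c, OF c(1)] c(3) monom_eval_add mult_ac)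
  show ?thesis
    unfolding pq mpoly_eval_sum[where c = c, OF c(1,2)] s
    by (simp add: mpoly_eval_def sum_product)
qed

lemma mpoly_ring_0: "0 \<in> mpoly_ring n"
  by (simp add: mpoly_ring_def)

lemma mpoly_ring_Const: "Const c \<in> mpoly_ring n"
  by (simp add: mpoly_ring_def Const_def)

lemma mpoly_ring_Var: "i \<le> n \<Longrightarrow> Var i \<in> mpoly_ring n"
  by (simp add: mpoly_ring_def Var_def)

lemma mpoly_ring_add: "p \<in> mpoly_ring n \<Longrightarrow> q \<in> mpoly_ring n \<Longrightarrow> p + q \<in> mpoly_ring n"
  using keys_add[of p q] unfolding mpoly_ring_def by blast

lemma mpoly_ring_mult:
  assumes "p \<in> mpoly_ring n" "q \<in> mpoly_ring n"
  shows "p * q \<in> mpoly_ring n"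
proof -
  have "Poly_Mapping.keys m \<subseteq> {0..n}" if m: "m \<in> Poly_Mapping.keys (p * q)" for m
  proof -
    from m keys_mult[of p q] obtain a b where "m = a + b"
      "a \<in> Poly_Mapping.keys p" "b \<in> Poly_Mapping.keys q" by blast
    then show ?thesis using assms keys_add[of a b] unfolding mpoly_ring_def by blast
  qed
  then show ?thesis by (simp add: mpoly_ring_def)
qed

lemma mpoly_ring_sum: "(\<And>i. i \<in> A \<Longrightarrow> p i \<in> mpoly_ring n) \<Longrightarrow> (\<Sum>i\<in>A. p i) \<in> mpoly_ring n"
  by (induction A rule: infinite_finite_induct) (auto simp: mpoly_ring_0 mpoly_ring_add)

lemma mpoly_ring_of_nat: "of_nat k \<in> mpoly_ring n"
  by (metis Const_def mpoly_ring_Const single_of_nat)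

lemma mpoly_ring_neg_one_power: "(-1) ^ k \<in> (mpoly_ring n :: 'a::comm_ring_1 mpoly set)"
proof (induction k)
  case 0
  then show ?case using mpoly_ring_of_nat[of 1 n] by simp
next
  case (Suc k)
  have "- 1 \<in> (mpoly_ring n :: 'a mpoly set)"
    using mpoly_ring_Const[of "- 1::'a" n] by (simp add: Const_def single_uminus)
  then show ?case using Suc mpoly_ring_mult by fastforce
qed

lemma mpoly_eval_self: "mpoly_eval Const Var p = (p :: 'a::comm_semiring_1 mpoly)"
proof -
  have c: "Const 0 = (0 :: 'a mpoly)" by (simp add: Const_def)
  have pow: "Var i ^ k = (Poly_Mapping.single (Poly_Mapping.single i k) 1 :: 'a mpoly)" for i k
    by (induction k) (simp_all add: Var_def mult_single flip: single_add)
  have pr: "(\<Prod>i\<in>S. Var i ^ h i) =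
      (Poly_Mapping.single (\<Sum>i\<in>S. Poly_Mapping.single i (h i)) 1 :: 'a mpoly)"
    if "finite S" for S and h :: "nat \<Rightarrow> nat"
    using that by (induction S rule: finite_induct) (simp_all add: pow mult_single)
  have m: "(\<Sum>i\<in>Poly_Mapping.keys m. Poly_Mapping.single i (Poly_Mapping.lookup m i)) = m"
    for m :: "nat \<Rightarrow>\<^sub>0 nat"
    by (rule poly_mapping_eqI)
      (auto simp: lookup_sum lookup_single when_def sum.delta in_keys_iff)
  show ?thesis
    by (subst (2) mpoly_sum_single) (simp add: mpoly_eval_def pr m Const_def mult_single)
qed

lemma derivation_exists:
  assumes g: "\<And>i. i \<le> n \<Longrightarrow> g i \<in> mpoly_ring n"
  shows "\<exists>D. derivation n D \<and> (\<forall>i. D (Var i) = g i)"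
proof -
  let ?c = "\<lambda>a::complex. [:Const a:]" and ?f = "\<lambda>i. [:Var i, g i:]"
  define E where "E = mpoly_eval ?c ?f"
  define D where "D p = coeff (E p) 1" for p
  have C0: "Const 0 = (0::complex mpoly)" by (simp add: Const_def)
  have Cadd: "Const (x + y) = Const x + Const y"
    and Cmult: "Const (x * y) = Const x * Const y" for x y :: complex
    by (simp_all add: Const_def single_add mult_single)
  have Eadd: "E (p + q) = E p + E q" and Emult: "E (p * q) = E p * E q" for p q
    unfolding E_def by (intro mpoly_eval_add mpoly_eval_mult; simp add: C0 Cadd Cmult)+
  have EC: "E (Const a) = [:Const a:]" for a
    unfolding E_def by (subst mpoly_eval_Const) (simp_all add: C0)
  have C1: "Const 1 = (1::complex mpoly)" by (simp add: Const_def)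
  have EV: "E (Var i) = [:Var i, g i:]" for i
    unfolding E_def by (subst mpoly_eval_Var) (simp_all add: C0 C1 one_pCons)
  have E0: "coeff (E p) 0 = p" for p
  proof -
    have "poly (E p) 0 = mpoly_eval Const Var p"
      by (simp add: E_def mpoly_eval_def poly_sum poly_prod)
    then show ?thesis by (simp add: mpoly_eval_self poly_0_coeff_0)
  qed
  define R where "R = {q. \<forall>k. coeff q k \<in> (mpoly_ring n :: complex mpoly set)}"
  have R_sum: "(\<Sum>i\<in>A. h i) \<in> R" if "\<And>i. i \<in> A \<Longrightarrow> h i \<in> R" for A :: "(nat \<Rightarrow>\<^sub>0 nat) set" and h
    using that by (auto simp: R_def coeff_sum intro!: mpoly_ring_sum)
  have R_mult: "p * q \<in> R" if "p \<in> R" "q \<in> R" for p q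
    using that by (auto simp: R_def coeff_mult intro!: mpoly_ring_sum mpoly_ring_mult)
  have R_c: "?c a \<in> R" for a
    by (auto simp: R_def coeff_pCons mpoly_ring_Const mpoly_ring_0 split: nat.splits)
  have R_1: "1 \<in> R"
    using R_c[of 1] by (simp add: C1 one_pCons)
  have R_f: "?f i \<in> R" if "i \<le> n" for i
    using that g by (auto simp: R_def coeff_pCons mpoly_ring_Var mpoly_ring_0 split: nat.splits)
  have R_pow: "p ^ k \<in> R" if "p \<in> R" for p k
    using that by (induction k) (auto simp: R_1 R_mult)
  have R_prod: "(\<Prod>i\<in>A. h i) \<in> R" if "\<And>i. i \<in> A \<Longrightarrow> h i \<in> R" for A :: "nat set" and h
    using that by (induction A rule: infinite_finite_induct) (auto simp: R_1 R_mult)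
  have "E p \<in> R" if p: "p \<in> mpoly_ring n" for p
    unfolding E_def mpoly_eval_def
  proof (intro R_sum R_mult R_c R_prod R_pow R_f)
    fix m i assume "m \<in> Poly_Mapping.keys p" "i \<in> Poly_Mapping.keys m"
    with p show "i \<le> n" unfolding mpoly_ring_def by fastforce
  qed
  then have Dring: "D p \<in> mpoly_ring n" if "p \<in> mpoly_ring n" for p
    using that by (simp add: D_def R_def)
  have Dmult: "D (p * q) = D p * q + p * D q" for p q
    by (simp add: D_def Emult coeff_mult E0 add.commute)
  have "derivation n D"
    unfolding derivation_def using Dring Dmult by (simp add: D_def Eadd Emult EC)
  moreover have "D (Var i) = g i" for i
    by (simp add: D_def EV)
  ultimately show ?thesis by blast
qed

lemma fibonacci_derivation_exists: "\<exists>D. fibonacci_derivation n D"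
proof -
  let ?g = "\<lambda>m. if m = 0 then 0 else
    (\<Sum>k=0..(m - 1) div 2. (-1) ^ k * of_nat (m - 1 - 2 * k) * Var (m - 1 - 2 * k)) :: complex mpoly"
  have "\<exists>D. derivation n D \<and> (\<forall>i. D (Var i) = ?g i)"
    by (rule derivation_exists) (auto intro!: mpoly_ring_sum mpoly_ring_mult mpoly_ring_of_nat
        mpoly_ring_neg_one_power mpoly_ring_Var mpoly_ring_0
        simp del: of_nat_diff of_nat_diff_if)
  then show ?thesis by (auto simp: fibonacci_derivation_def)
qed

lemma lucas_derivation_exists: "\<exists>D. lucas_derivation n D"
proof -
  let ?g = "\<lambda>m. if m = 0 then 0 else
    of_nat m * (\<Sum>k=0..(m - 1) div 2. (-1) ^ k * Var (m - 1 - 2 * k)) :: complex mpoly"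
  have "\<exists>D. derivation n D \<and> (\<forall>i. D (Var i) = ?g i)"
    by (rule derivation_exists) (auto intro!: mpoly_ring_sum mpoly_ring_mult mpoly_ring_of_nat
        mpoly_ring_neg_one_power mpoly_ring_Var mpoly_ring_0)
  then show ?thesis by (auto simp: lucas_derivation_def)
qed

end

theory Submission
  imports Defs
begin

text \<open>
  Both derivations imitate \<open>d/dx\<close>: the prescribed values \<open>\<D>\<^sub>\<F>(x\<^sub>m)\<close> and \<open>\<D>\<^sub>\<L>(x\<^sub>m)\<close> are chosen so
  that substituting the Fibonacci (or Lucas) polynomials turns them into \<open>F\<^sub>m'\<close> and \<open>L\<^sub>m'\<close>. Since
  \<open>d/dx\<close> also satisfies Leibniz's rule, agreement on the variables spreads to the whole polynomial
  ring (\<open>eval_derivation_eq_pderiv\<close>): applying the derivation and then substituting is the same as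
  substituting and then differentiating. So if the derivation kills \<open>P\<close>, the substituted polynomial
  has derivative zero, and in characteristic zero it is constant.

  Agreement on the variables rests on two identities,
  \<open>F\<^sub>m\<^sub>+\<^sub>2' + F\<^sub>m' = (m + 1) F\<^sub>m\<^sub>+\<^sub>1\<close> and \<open>L\<^sub>m\<^sub>+\<^sub>1 = F\<^sub>m\<^sub>+\<^sub>2 + F\<^sub>m\<close>. Solving the first for \<open>F\<^sub>m\<^sub>+\<^sub>2'\<close>
  and iterating gives the alternating sum in \<open>\<D>\<^sub>\<F>\<close>. Together they give \<open>L\<^sub>m' = m F\<^sub>m\<close>, and solving the
  second for \<open>F\<^sub>m\<^sub>+\<^sub>2\<close> and iterating expands this \<open>F\<^sub>m\<close> into the alternating sum in \<open>\<D>\<^sub>\<L>\<close>.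
\<close>

section \<open>Generation of the polynomial ring\<close>

text \<open>
  A polynomial is recovered by substituting its own variables into it, which displays it as built
  from constants and variables by the ring operations.
\<close>

lemma mpoly_ring_induct [consumes 1, case_names Const Var add mult]:
  fixes p :: "'a::comm_semiring_1 mpoly"
  assumes p: "p \<in> mpoly_ring n"
    and Const: "\<And>c. Q (Const c)"
    and Var: "\<And>i. i \<le> n \<Longrightarrow> Q (Var i)"
    and add: "\<And>p q. p \<in> mpoly_ring n \<Longrightarrow> q \<in> mpoly_ring n \<Longrightarrow> Q p \<Longrightarrow> Q q \<Longrightarrow> Q (p + q)"
    and mult: "\<And>p q. p \<in> mpoly_ring n \<Longrightarrow> q \<in> mpoly_ring n \<Longrightarrow> Q p \<Longrightarrow> Q q \<Longrightarrow> Q (p * q)"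
  shows "Q p"
proof -
  define R where "R = {p \<in> mpoly_ring n. Q p}"
  have C: "Const c \<in> R" for c
    by (simp add: R_def mpoly_ring_Const Const)
  have zero: "0 \<in> R" and one: "1 \<in> R"
    using C[of 0] C[of 1] by (simp_all add: Const_def)
  have V: "Var i \<in> R" if "i \<le> n" for i
    using that by (simp add: R_def mpoly_ring_Var Var)
  have M: "q * r \<in> R" if "q \<in> R" "r \<in> R" for q r
    using that by (simp add: R_def mpoly_ring_mult mult)
  have pow: "q ^ k \<in> R" if "q \<in> R" for q k
    using that by (induction k) (auto simp: one M)
  have A: "q + r \<in> R" if "q \<in> R" "r \<in> R" for q r
    using that by (simp add: R_def mpoly_ring_add add)
  have S: "sum h A \<in> R" if "\<And>i. i \<in> A \<Longrightarrow> h i \<in> R" for A :: "(nat \<Rightarrow>\<^sub>0 nat) set" and h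
    using that by (induction A rule: infinite_finite_induct) (auto simp: zero A)
  have Pr: "prod h A \<in> R" if "\<And>i. i \<in> A \<Longrightarrow> h i \<in> R" for A :: "nat set" and h
    using that by (induction A rule: infinite_finite_induct) (auto simp: one M)
  have "mpoly_eval Const Var p \<in> R"
    unfolding mpoly_eval_def
  proof (intro S M C Pr pow V)
    fix m i assume "m \<in> Poly_Mapping.keys p" "i \<in> Poly_Mapping.keys m"
    with p show "i \<le> n" unfolding mpoly_ring_def by fastforce
  qed
  then show ?thesis by (simp add: mpoly_eval_self R_def)
qed

section \<open>Derivations that act as differentiation\<close>

lemma derivation_Const:
  assumes "derivation n D"
  shows "D (Const c) = 0"
proof -
  have one: "(1 :: complex mpoly) \<in> mpoly_ring n"
    using mpoly_ring_of_nat[of 1 n] by simp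
  have "D (1 * 1) = D 1 * 1 + 1 * D 1"
    using assms one unfolding derivation_def by blast
  then have "D 1 = 0" by simp
  moreover have "D (Const c * 1) = Const c * D 1"
    using assms one unfolding derivation_def by blast
  ultimately show ?thesis by simp
qed

context
  fixes f :: "nat \<Rightarrow> complex poly"
begin

abbreviation (input) subst :: "complex mpoly \<Rightarrow> complex poly"
  where "subst \<equiv> mpoly_eval (\<lambda>a. [:a:]) f"

lemma subst_ring_hom:
  "subst 0 = 0" "subst 1 = 1" "subst (Const c) = [:c:]" "subst (Var i) = f i"
  "subst (p + q) = subst p + subst q" "subst (p * q) = subst p * subst q"
  "subst (- p) = - subst p" "subst (p ^ k) = subst p ^ k" "subst (of_nat k) = of_nat k"
  "subst (sum h A) = (\<Sum>i\<in>A. subst (h i))"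
proof -
  show zero: "subst 0 = 0" by (simp add: mpoly_eval_def)
  show C: "subst (Const c) = [:c:]" for c by (simp add: mpoly_eval_Const)
  from C[of 1] show one: "subst 1 = 1" by (simp add: Const_def one_pCons)
  show "subst (Var i) = f i" by (simp add: mpoly_eval_Var one_pCons)
  show add: "subst (p + q) = subst p + subst q" for p q by (simp add: mpoly_eval_add)
  show mult: "subst (p * q) = subst p * subst q" for p q by (simp add: mpoly_eval_mult)
  show "subst (- p) = - subst p"
    using add[of p "- p"] zero by (simp add: eq_neg_iff_add_eq_0 add.commute)
  show "subst (p ^ k) = subst p ^ k" by (induction k) (simp_all add: one mult)
  show "subst (of_nat k) = of_nat k" by (induction k) (simp_all add: zero one add)
  show "subst (sum h A) = (\<Sum>i\<in>A. subst (h i))" by (simp add: mpoly_eval_sum)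
qed

text \<open>
  Both \<open>subst \<circ> D\<close> and \<open>pderiv \<circ> subst\<close> are derivations along the ring homomorphism \<open>subst\<close>, and
  such a map is determined by its values on the variables.
\<close>

lemma eval_derivation_eq_pderiv:
  assumes D: "derivation n D"
    and Var: "\<And>i. i \<le> n \<Longrightarrow> subst (D (Var i)) = pderiv (f i)"
    and p: "p \<in> mpoly_ring n"
  shows "subst (D p) = pderiv (subst p)"
  using p
proof (induction p rule: mpoly_ring_induct)
  case (Const c)
  then show ?case
    by (simp add: derivation_Const[OF D] subst_ring_hom pderiv_pCons)
next
  case (Var i)
  then show ?case by (simp add: assms(2) subst_ring_hom)
next
  case (add p q)
  have "D (p + q) = D p + D q"
    using D add.hyps unfolding derivation_def by blast
  then show ?case using add.IH by (simp add: subst_ring_hom pderiv_add)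
next
  case (mult p q)
  have "D (p * q) = D p * q + p * D q"
    using D mult.hyps unfolding derivation_def by blast
  then show ?case using mult.IH by (simp add: subst_ring_hom pderiv_mult algebra_simps)
qed

lemma eval_kernel_constant:
  assumes "derivation n D" "\<And>i. i \<le> n \<Longrightarrow> subst (D (Var i)) = pderiv (f i)"
    and "p \<in> mpoly_ring n" "D p = 0"
  shows "\<exists>c. subst p = [:c:]"
proof -
  have "pderiv (subst p) = 0"
    using eval_derivation_eq_pderiv[OF assms(1-3)] assms(4) by (simp add: subst_ring_hom)
  then show ?thesis by (rule pderiv_iszero)
qed

end

section \<open>Derivatives of Fibonacci and Lucas polynomials\<close>

lemma nth_mult_gf_denom:
  "fps_nth (g * gf_denom) 0 = fps_nth g 0"
  "fps_nth (g * gf_denom) (Suc 0) = fps_nth g (Suc 0) - [:0, 1:] * fps_nth g 0"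
  "fps_nth (g * gf_denom) (Suc (Suc m)) =
     fps_nth g (Suc (Suc m)) - [:0, 1:] * fps_nth g (Suc m) - fps_nth g m"
proof -
  have "g * gf_denom = g - fps_const [:0, 1:] * (g * fps_X) - g * fps_X ^ 2"
    by (simp add: gf_denom_def algebra_simps)
  then show
    "fps_nth (g * gf_denom) 0 = fps_nth g 0"
    "fps_nth (g * gf_denom) (Suc 0) = fps_nth g (Suc 0) - [:0, 1:] * fps_nth g 0"
    "fps_nth (g * gf_denom) (Suc (Suc m)) =
       fps_nth g (Suc (Suc m)) - [:0, 1:] * fps_nth g (Suc m) - fps_nth g m"
    by (simp_all add: fps_X_power_mult_right_nth del: mult_pCons_left mult_pCons_right)
qed

lemma fibonacci_poly_rec:
  "fibonacci_poly 0 = 0" "fibonacci_poly (Suc 0) = 1"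
  "fibonacci_poly (Suc (Suc m)) = [:0, 1:] * fibonacci_poly (Suc m) + fibonacci_poly m"
proof -
  show zero: "fibonacci_poly 0 = 0"
    using nth_mult_gf_denom(1)[of fibonacci_gf] by (simp add: fibonacci_gf fibonacci_poly_def)
  show "fibonacci_poly (Suc 0) = 1"
    using nth_mult_gf_denom(2)[of fibonacci_gf] zero
    by (simp add: fibonacci_gf fibonacci_poly_def)
  show "fibonacci_poly (Suc (Suc m)) = [:0, 1:] * fibonacci_poly (Suc m) + fibonacci_poly m"
    using nth_mult_gf_denom(3)[of fibonacci_gf m]
    by (simp add: fibonacci_gf fibonacci_poly_def diff_diff_eq
        del: mult_pCons_left mult_pCons_right)
qed

text \<open>The generating function of the Lucas polynomials is \<open>(1 + t\<^sup>2) / t\<close> times the Fibonacci one.\<close>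

lemma lucas_poly_eq_fibonacci:
  "lucas_poly 0 = 1"
  "lucas_poly (Suc m) = fibonacci_poly (Suc (Suc m)) + fibonacci_poly m"
proof -
  show "lucas_poly 0 = 1"
    by (simp add: lucas_poly_def lucas_gf_def)
  have "fps_X * lucas_gf = fibonacci_gf + fps_X ^ 2 * fibonacci_gf"
    by (simp add: lucas_gf_def fibonacci_gf_def algebra_simps)
  then have "fps_nth (fps_X * lucas_gf) (Suc (Suc m)) =
      fps_nth (fibonacci_gf + fps_X ^ 2 * fibonacci_gf) (Suc (Suc m))"
    by simp
  then show "lucas_poly (Suc m) = fibonacci_poly (Suc (Suc m)) + fibonacci_poly m"
    by (simp add: lucas_poly_def fibonacci_poly_def fps_X_power_mult_nth)
qed

text \<open>
  With \<open>G = t / (1 - xt - t\<^sup>2)\<close> this says \<open>(1 + t\<^sup>2) \<partial>G/\<partial>x = t\<^sup>2 \<partial>G/\<partial>t\<close>. It is proved through the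
  recurrence: the difference of the two sides satisfies the Fibonacci recurrence and starts with
  two zeros.
\<close>

lemma pderiv_fibonacci_poly:
  "pderiv (fibonacci_poly (Suc (Suc m))) + pderiv (fibonacci_poly m) =
     of_nat (Suc m) * fibonacci_poly (Suc m)"
proof (induction m rule: less_induct)
  case (less m)
  have pderiv_x: "pderiv [:0, 1 :: complex:] = 1"
    by (simp add: pderiv_pCons one_pCons)
  have d: "pderiv (fibonacci_poly (Suc (Suc k))) = fibonacci_poly (Suc k) +
      [:0, 1:] * pderiv (fibonacci_poly (Suc k)) + pderiv (fibonacci_poly k)" for k
    unfolding fibonacci_poly_rec(3) pderiv_add pderiv_mult pderiv_x
    by (simp del: mult_pCons_left mult_pCons_right)
  consider "m = 0" | "m = Suc 0" | k where "m = Suc (Suc k)"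
    by (metis old.nat.exhaust)
  then show ?case
  proof cases
    case 1
    then show ?thesis by (simp add: d fibonacci_poly_rec(1,2))
  next
    case 2
    then show ?thesis
      by (simp add: d fibonacci_poly_rec pderiv_add pderiv_mult pderiv_x
          del: mult_pCons_left mult_pCons_right)
        (simp add: numeral_poly)
  next
    case 3
    define x where "x = [:0, 1 :: complex:]"
    note d = d[folded x_def]
    have F: "fibonacci_poly (Suc (Suc (Suc k))) =
        x * fibonacci_poly (Suc (Suc k)) + fibonacci_poly (Suc k)"
      by (simp only: fibonacci_poly_rec(3)[of "Suc k"] x_def)
    have "pderiv (fibonacci_poly (Suc (Suc m))) + pderiv (fibonacci_poly m) =
        fibonacci_poly (Suc (Suc (Suc k))) + fibonacci_poly (Suc k)
        + x * (pderiv (fibonacci_poly (Suc (Suc (Suc k)))) + pderiv (fibonacci_poly (Suc k)))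
        + (pderiv (fibonacci_poly (Suc (Suc k))) + pderiv (fibonacci_poly k))"
      unfolding 3 by (subst d[of "Suc (Suc k)"], subst d[of k]) (simp add: algebra_simps)
    also have "\<dots> = fibonacci_poly (Suc (Suc (Suc k))) + fibonacci_poly (Suc k)
        + x * (of_nat (Suc (Suc k)) * fibonacci_poly (Suc (Suc k)))
        + of_nat (Suc k) * fibonacci_poly (Suc k)"
      using less.IH[of k] less.IH[of "Suc k"] 3 by simp
    also have "\<dots> = of_nat (Suc m) * fibonacci_poly (Suc m)"
      unfolding 3 F by (simp add: algebra_simps)
    finally show ?thesis .
  qed
qed

lemma pderiv_lucas_poly: "pderiv (lucas_poly m) = of_nat m * fibonacci_poly m"
proof (cases m)
  case 0
  then show ?thesis by (simp add: lucas_poly_eq_fibonacci(1))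
next
  case (Suc k)
  then show ?thesis
    by (simp only: lucas_poly_eq_fibonacci(2) pderiv_add pderiv_fibonacci_poly)
qed

text \<open>
  The inverse of the summation \<open>b\<^sub>m\<^sub>+\<^sub>1 = a\<^sub>m\<^sub>+\<^sub>2 + a\<^sub>m\<close>, that is, division of a generating function by
  \<open>1 + t\<^sup>2\<close>.
\<close>

lemma alternating_sum_recurrence:
  fixes a b :: "nat \<Rightarrow> 'a::comm_ring_1"
  assumes "a 0 = 0" "a (Suc 0) = b 0" "\<And>m. a (Suc (Suc m)) + a m = b (Suc m)"
  shows "a (Suc m) = (\<Sum>k=0..m div 2. (-1) ^ k * b (m - 2 * k))"
proof (induction m rule: less_induct)
  case (less m)
  have step: "a (Suc (Suc k)) = b (Suc k) - a k" for k
    using assms(3)[of k] by (simp add: algebra_simps)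
  consider "m = 0" | "m = Suc 0" | k where "m = Suc (Suc k)"
    by (metis old.nat.exhaust)
  then show ?case
  proof cases
    case 3
    have "(\<Sum>j=0..m div 2. (-1) ^ j * b (m - 2 * j)) =
        b m + (\<Sum>j=0..k div 2. (-1) ^ Suc j * b (k - 2 * j))"
    proof -
      have half: "m div 2 = Suc (k div 2)" using 3 by simp
      show ?thesis
        unfolding half sum.atLeast0_atMost_Suc_shift using 3 by (simp del: power_Suc)
    qed
    also have "\<dots> = b m - a (Suc k)"
      using less.IH[of k] 3 by (simp add: sum_negf)
    finally show ?thesis using step[of "Suc k"] 3 by simp
  qed (use assms in \<open>simp_all add: step\<close>)
qed

lemma fibonacci_derivation_Var:
  assumes "fibonacci_derivation n D" "m \<le> n"
  shows "mpoly_eval (\<lambda>a. [:a:]) fibonacci_poly (D (Var m)) = pderiv (fibonacci_poly m)"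
proof (cases m)
  case 0
  then show ?thesis
    using assms by (simp add: fibonacci_derivation_def subst_ring_hom fibonacci_poly_rec)
next
  case (Suc k)
  have "pderiv (fibonacci_poly (Suc k)) =
      (\<Sum>j=0..k div 2. (-1) ^ j * (of_nat (k - 2 * j) * fibonacci_poly (k - 2 * j)))"
    by (rule alternating_sum_recurrence[where b = "\<lambda>j. of_nat j * fibonacci_poly j"])
      (simp_all only: pderiv_fibonacci_poly, simp_all add: fibonacci_poly_rec)
  moreover have "D (Var m) =
      (\<Sum>j=0..k div 2. (-1) ^ j * of_nat (k - 2 * j) * Var (k - 2 * j))"
    using assms Suc by (simp add: fibonacci_derivation_def del: of_nat_diff of_nat_diff_if)
  ultimately show ?thesis
    using Suc by (simp add: subst_ring_hom mult.assoc del: of_nat_diff of_nat_diff_if)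
qed

lemma lucas_derivation_Var:
  assumes "lucas_derivation n D" "m \<le> n"
  shows "mpoly_eval (\<lambda>a. [:a:]) lucas_poly (D (Var m)) = pderiv (lucas_poly m)"
proof (cases m)
  case 0
  then show ?thesis
    using assms by (simp add: lucas_derivation_def subst_ring_hom pderiv_lucas_poly)
next
  case (Suc k)
  have "fibonacci_poly (Suc k) = (\<Sum>j=0..k div 2. (-1) ^ j * lucas_poly (k - 2 * j))"
    by (rule alternating_sum_recurrence)
      (simp_all only: lucas_poly_eq_fibonacci fibonacci_poly_rec(1,2))
  moreover have "D (Var m) = of_nat m * (\<Sum>j=0..k div 2. (-1) ^ j * Var (k - 2 * j))"
    using assms Suc by (simp add: lucas_derivation_def)
  ultimately show ?thesis
    using Suc by (simp only: subst_ring_hom pderiv_lucas_poly)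
qed

theorem theorem2p2:
  fixes n :: nat and P :: "complex mpoly"
    and D_F D_L :: "complex mpoly \<Rightarrow> complex mpoly"
  assumes "P \<in> mpoly_ring n"
    and "fibonacci_derivation n D_F"
    and "lucas_derivation n D_L"
  shows "(D_F P = 0 \<longrightarrow> (\<exists>c::complex. mpoly_eval (\<lambda>a. [:a:]) fibonacci_poly P = [:c:])) \<and>
         (D_L P = 0 \<longrightarrow> (\<exists>c::complex. mpoly_eval (\<lambda>a. [:a:]) lucas_poly P = [:c:]))"
proof (intro conjI impI)
  assume "D_F P = 0"
  then show "\<exists>c. mpoly_eval (\<lambda>a. [:a:]) fibonacci_poly P = [:c:]"
    using assms(1,2) fibonacci_derivation_Var
    by (intro eval_kernel_constant[of n D_F]) (auto simp: fibonacci_derivation_def)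
next
  assume "D_L P = 0"
  then show "\<exists>c. mpoly_eval (\<lambda>a. [:a:]) lucas_poly P = [:c:]"
    using assms(1,3) lucas_derivation_Var
    by (intro eval_kernel_constant[of n D_L]) (auto simp: lucas_derivation_def)
qed

end
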